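(* For every $\varepsilon>0$ and all integers $n\ge 2$, $s\ge 1$ there exist a positive integer $m$ and a non-empty set $X\subseteq\{0,1,\dots,m-1\}^n$ such that (i) for all $i\in[n]$, $AvgDeg_i(X)\ge s(n-\varepsilon)$; (ii) there is no non-empty $Y\subseteq X$ such that $MinDeg_i(Y)\ge s+1$ for all $i\in[n]$.
   Context: For a finite set $A$, $X\subseteq A^n$ and $S=\{i_1<\dots<i_k\}\subseteq[n]$, let $X_S=\{(x_{i_1},\dots,x_{i_k}):(x_1,\dots,x_n)\in X\}$. For $i\in[n]$, $G_i(X)$ is the bipartite graph with left vertex set $A$, right vertex set $X_{[n]\setminus\{i\}}$, and an edge between $a\in A$ and $(x_1,\dots,x_{i-1},x_{i+1},\dots,x_n)$ iff $(x_1,\dots,x_{i-1},a,x_{i+1},\dots,x_n)\in X$. $MinDeg_i(X)$ is the minimum degree of a right vertex of $G_i(X)$, and $AvgDeg_i(X)=|X|/|X_{[n]\setminus\{i\}}|$. *)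

theory Defs
  imports Complex_Main "HOL-Library.FuncSet"
begin

text \<open>
  Tuples in \<open>A\<^sup>n\<close> are the extensional functions \<open>{1..n} \<rightarrow>\<^sub>E A\<close>. A tuple indexed by
  \<open>S = {i\<^sub>1 < \<dots> < i\<^sub>k}\<close> is an extensional function on \<open>S\<close>, so \<open>X\<^sub>S\<close> consists of restrictions,
  and inserting \<open>a\<close> at position \<open>i\<close> into a tuple \<open>y\<close> over \<open>{1..n} - {i}\<close> is \<open>y(i := a)\<close>.
\<close>

definition coord_proj :: "nat set \<Rightarrow> (nat \<Rightarrow> 'a) set \<Rightarrow> (nat \<Rightarrow> 'a) set" where
  "coord_proj S X = (\<lambda>x. restrict x S) ` X"

record ('l, 'r) bigraph =
  left_verts :: "'l set"
  right_verts :: "'r set"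
  bi_edges :: "('l \<times> 'r) set"

definition right_degree :: "('l, 'r) bigraph \<Rightarrow> 'r \<Rightarrow> nat" where
  "right_degree G v = card {u \<in> left_verts G. (u, v) \<in> bi_edges G}"

definition coord_graph ::
  "'a set \<Rightarrow> nat \<Rightarrow> nat \<Rightarrow> (nat \<Rightarrow> 'a) set \<Rightarrow> ('a, nat \<Rightarrow> 'a) bigraph" where
  "coord_graph A n i X =
    \<lparr> left_verts = A,
      right_verts = coord_proj ({1..n} - {i}) X,
      bi_edges = {(a, y). a \<in> A \<and> y \<in> coord_proj ({1..n} - {i}) X \<and> y(i := a) \<in> X} \<rparr>"

text \<open>Only meaningful for finite non-empty \<open>X\<close>, because of \<^const>\<open>Min\<close>.\<close>

definition MinDeg :: "'a set \<Rightarrow> nat \<Rightarrow> nat \<Rightarrow> (nat \<Rightarrow> 'a) set \<Rightarrow> nat" where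
  "MinDeg A n i X =
    Min (right_degree (coord_graph A n i X) ` right_verts (coord_graph A n i X))"

definition AvgDeg :: "nat \<Rightarrow> nat \<Rightarrow> (nat \<Rightarrow> 'a) set \<Rightarrow> real" where
  "AvgDeg n i X = real (card X) / real (card (coord_proj ({1..n} - {i}) X))"

end

theory Submission
  imports Defs
begin

text \<open>
  Take \<open>X\<close> to be the set of lattice points of the positive orthant whose coordinate sum lies in
  \<open>[t, t + n s)\<close>. Almost all lines meeting \<open>X\<close> meet it in exactly \<open>n s\<close> points once \<open>t\<close> is suitable,
  because the projections grow only polynomially in \<open>t\<close>. Cut the range of sums into \<open>n\<close> blocks of
  length \<open>s\<close> and assign direction \<open>i\<close> to the \<open>i\<close>-th block. There is a potential (a convex
  function of the sum, with a different slope on each block, minus a linear functional) that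
  strictly increases whenever a point of block \<open>i\<close> is moved in direction \<open>i\<close> into another block.
  Hence a point of \<open>Y\<close> of maximal
  potential, say in block \<open>i\<close>, has a line in direction \<open>i\<close> that meets \<open>Y\<close> in block \<open>i\<close> only, that is,
  in at most \<open>s\<close> points.
\<close>

section \<open>Polynomial growth against exponential growth\<close>

text \<open>One \<open>t\<close> has to serve all \<open>i\<close> at once. If every
  \<open>t\<close> fails for some \<open>i\<close>, the product of the family gains a factor
  \<open>1 + \<delta>\<close> over each \<open>K\<close> steps, as the other factors do not
  decrease; such exponential growth contradicts the polynomial bound on the product.\<close>

lemma poly_bounded_family_slow_step:
  fixes f :: "'i \<Rightarrow> nat \<Rightarrow> real"
  assumes fin: "finite I" and d: "\<delta> > 0"
    and mono: "\<And>i. i \<in> I \<Longrightarrow> mono (f i)"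
    and ge1: "\<And>i T. i \<in> I \<Longrightarrow> 1 \<le> f i T"
    and bound: "\<And>i T. i \<in> I \<Longrightarrow> f i T \<le> (real T + 1) ^ d"
  shows "\<exists>t. \<forall>i\<in>I. f i (t + K) \<le> (1 + \<delta>) * f i t"
proof (rule ccontr)
  assume "\<not> ?thesis"
  then have step: "\<exists>i\<in>I. f i (t + K) > (1 + \<delta>) * f i t" for t
    by (meson not_le)
  define g where "g t = (\<Prod>i\<in>I. f i t)" for t
  have g_step: "(1 + \<delta>) * g t \<le> g (t + K)" for t
  proof -
    obtain i where i: "i \<in> I" "f i (t + K) > (1 + \<delta>) * f i t"
      using step by blast
    have "(1 + \<delta>) * g t = ((1 + \<delta>) * f i t) * (\<Prod>j\<in>I - {i}. f j t)"
      unfolding g_def using fin i by (simp add: prod.remove[of I i])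
    also have "\<dots> \<le> f i (t + K) * (\<Prod>j\<in>I - {i}. f j (t + K))"
    proof (intro mult_mono prod_mono prod_nonneg conjI)
      show "(1 + \<delta>) * f i t \<le> f i (t + K)" using i by simp
      show "0 \<le> f i (t + K)" using ge1[OF i(1), of "t + K"] by linarith
    next
      fix j assume j: "j \<in> I - {i}"
      show "f j t \<le> f j (t + K)" using j mono[of j] by (simp add: mono_def)
      show "0 \<le> f j t" "0 \<le> f j t" using j ge1[of j t] by auto
    qed
    also have "\<dots> = g (t + K)"
      unfolding g_def using fin i by (simp add: prod.remove[of I i])
    finally show ?thesis .
  qed
  have lower: "(1 + \<delta>) ^ q \<le> g (q * K)" for q
  proof (induction q)
    case 0
    then show ?case unfolding g_def using ge1 by (simp add: prod_ge_1)
  next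
    case (Suc q)
    have "(1 + \<delta>) ^ Suc q \<le> (1 + \<delta>) * g (q * K)" using Suc d by simp
    also have "\<dots> \<le> g (q * K + K)" by (rule g_step)
    finally show ?case by (simp add: add.commute)
  qed
  have upper: "g T \<le> (real T + 1) ^ (d * card I)" for T
  proof -
    have "g T \<le> (\<Prod>i\<in>I. (real T + 1) ^ d)"
      unfolding g_def
    proof (intro prod_mono conjI)
      fix i assume "i \<in> I"
      then show "0 \<le> f i T" "f i T \<le> (real T + 1) ^ d"
        using ge1[of i T] bound by auto
    qed
    then show ?thesis by (simp add: power_mult)
  qed
  define e where "e = d * card I"
  define a where "a = ln (1 + \<delta>)"
  have a: "a > 0" using d by (simp add: a_def)
  have expo: "(1 + \<delta>) ^ q = exp (a * real q)" for q
    using d by (simp add: a_def mult.commute[of "ln _"] exp_of_nat_mult)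
  have "((\<lambda>x::real. x ^ e / exp x) \<longlongrightarrow> 0) at_top"
    by (rule tendsto_power_div_exp_0)
  moreover have "filterlim (\<lambda>q. a * real q) at_top sequentially"
    by (rule filterlim_tendsto_pos_mult_at_top[OF tendsto_const a filterlim_real_sequentially])
  ultimately have "(\<lambda>q. (a * real q) ^ e / exp (a * real q)) \<longlonglongrightarrow> 0"
    by (rule filterlim_compose)
  \<comment> \<open>This \<open>c\<close> is the ratio of \<open>(a * q) ^ e\<close> to
    \<open>(q * (K + 1)) ^ e\<close>, the latter bounding \<open>(q * K + 1) ^ e\<close> once
    \<open>q \<ge> 1\<close>.\<close>
  moreover define c where "c = (a / (real K + 1)) ^ e"
  have c: "c > 0" using a by (simp add: c_def)
  ultimately have "\<forall>\<^sub>F q in sequentially. (a * real q) ^ e / exp (a * real q) < c"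
    by (rule order_tendstoD)
  then have "\<forall>\<^sub>F q in sequentially. (a * real q) ^ e / exp (a * real q) < c \<and> q \<ge> 1"
    using eventually_ge_at_top[of 1] by (rule eventually_conj)
  then obtain q where q: "(a * real q) ^ e / exp (a * real q) < c" "q \<ge> 1"
    by (auto simp: eventually_sequentially)
  have "(1 + \<delta>) ^ q \<le> (real (q * K) + 1) ^ e"
    using lower[of q] upper[of "q * K"] by (simp add: e_def)
  also have "\<dots> \<le> (real q * (real K + 1)) ^ e"
    using q(2) by (intro power_mono) (auto simp: algebra_simps)
  finally have "c * exp (a * real q) \<le> c * (real q * (real K + 1)) ^ e"
    using c by (simp add: expo)
  also have "\<dots> = (a * real q) ^ e"
    unfolding c_def power_mult_distrib[symmetric]
    by (rule arg_cong[where f = "\<lambda>z. z ^ e"]) (simp add: divide_simps add_nonneg_eq_0_iff)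
  finally show False using q(1) by (simp add: field_simps)
qed

section \<open>Counting lattice points of simplices and slabs\<close>

lemma sum_fun_upd_remove:
  assumes "finite A" and "i \<in> A"
  shows "sum (f(i := v)) A = v + sum f (A - {i})"
  using assms by (auto simp: sum.remove[of A i] intro!: sum.cong)

text \<open>These simplices enclose the projections of the slab from both sides: size
  \<open>t\<close> gives lines that meet the slab in \<open>n * s\<close> points, size
  \<open>t + n * s\<close> contains the whole projection.\<close>

definition simplex_pts :: "nat set \<Rightarrow> nat \<Rightarrow> (nat \<Rightarrow> nat) set" where
  "simplex_pts S T = {y \<in> S \<rightarrow>\<^sub>E {0..T}. sum y S \<le> T}"

lemma finite_simplex_pts: "finite S \<Longrightarrow> finite (simplex_pts S T)"
  unfolding simplex_pts_def by (simp add: finite_PiE)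

lemma card_simplex_pts_le:
  assumes "finite S"
  shows "card (simplex_pts S T) \<le> (T + 1) ^ card S"
proof -
  have "card (simplex_pts S T) \<le> card (S \<rightarrow>\<^sub>E {0..T})"
    unfolding simplex_pts_def using assms by (intro card_mono) (auto simp: finite_PiE)
  then show ?thesis using assms by (simp add: card_PiE)
qed

lemma card_simplex_pts_pos:
  assumes "finite S"
  shows "1 \<le> card (simplex_pts S T)"
proof -
  have "restrict (\<lambda>_. 0) S \<in> simplex_pts S T"
    by (auto simp: simplex_pts_def)
  then show ?thesis
    using finite_simplex_pts[OF assms, of T] by (metis One_nat_def Suc_leI card_gt_0_iff empty_iff)
qed

lemma simplex_pts_mono:
  assumes "T \<le> T'"
  shows "simplex_pts S T \<subseteq> simplex_pts S T'"
  using assms unfolding simplex_pts_def by (force simp: PiE_iff)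

text \<open>The alphabet size \<open>m\<close> of the theorem is \<open>t + n * s\<close>, large
  enough to keep every lattice point of the slab.\<close>

definition slab_pts :: "nat \<Rightarrow> nat \<Rightarrow> nat \<Rightarrow> (nat \<Rightarrow> nat) set" where
  "slab_pts n s t =
    {x \<in> {1..n} \<rightarrow>\<^sub>E {0..<t + n * s}. t \<le> sum x {1..n} \<and> sum x {1..n} < t + n * s}"

lemma finite_slab_pts: "finite (slab_pts n s t)"
  unfolding slab_pts_def by (simp add: finite_PiE)

lemma coord_proj_slab_pts:
  "coord_proj ({1..n} - {i}) (slab_pts n s t) \<subseteq> simplex_pts ({1..n} - {i}) (t + n * s)"
proof
  fix y assume "y \<in> coord_proj ({1..n} - {i}) (slab_pts n s t)"
  then obtain x where x: "x \<in> slab_pts n s t" "y = restrict x ({1..n} - {i})"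
    by (auto simp: coord_proj_def)
  have "sum y ({1..n} - {i}) = sum x ({1..n} - {i})"
    using x by (auto intro: sum.cong)
  also have "\<dots> \<le> sum x {1..n}" by (intro sum_mono2) auto
  also have "\<dots> \<le> t + n * s" using x by (auto simp: slab_pts_def)
  finally show "y \<in> simplex_pts ({1..n} - {i}) (t + n * s)"
    using x by (auto simp: simplex_pts_def slab_pts_def PiE_iff less_imp_le)
qed

text \<open>A point \<open>y\<close> with sum at most \<open>t\<close> leaves room for all
  \<open>n * s\<close> admissible totals: coordinate \<open>i\<close> can be filled in to reach each
  of \<open>t, ..., t + n * s - 1\<close>.\<close>

lemma card_slab_pts_ge:
  assumes i: "i \<in> {1..n}"
  shows "n * s * card (simplex_pts ({1..n} - {i}) t) \<le> card (slab_pts n s t)"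
proof -
  let ?S = "{1..n} - {i}"
  \<comment> \<open>The new coordinate makes the total exactly \<open>t + d\<close>; the natural
    subtraction does not truncate because \<open>sum y ?S \<le> t\<close>.\<close>
  define h where "h = (\<lambda>(y, d). y(i := t - sum y ?S + d))"
  have sum_upd: "sum (y(i := v)) {1..n} = v + sum y ?S" for y and v :: nat
    using i by (intro sum_fun_upd_remove) auto
  have "inj_on h (simplex_pts ?S t \<times> {..<n * s})"
  proof (rule inj_onI, clarify)
    fix y d y' d'
    assume y: "y \<in> simplex_pts ?S t" and y': "y' \<in> simplex_pts ?S t"
      and eq: "h (y, d) = h (y', d')"
    have "y = y'"
    proof
      fix k
      \<comment> \<open>The update overwrites coordinate \<open>i\<close>, so agreement of
        \<open>y\<close> and \<open>y'\<close> there comes from extensionality.\<close>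
      have "y i = undefined" "y' i = undefined"
        using y y' by (auto simp: simplex_pts_def PiE_iff extensional_def)
      then show "y k = y' k"
        using fun_cong[OF eq, of k] by (auto simp: h_def split: if_splits)
    qed
    moreover have "d = d'"
      using fun_cong[OF eq, of i] \<open>y = y'\<close> by (simp add: h_def)
    ultimately show "y = y' \<and> d = d'" by simp
  qed
  moreover have "h ` (simplex_pts ?S t \<times> {..<n * s}) \<subseteq> slab_pts n s t"
  proof clarify
    fix y d assume y: "y \<in> simplex_pts ?S t" and d: "d < n * s"
    have le: "sum y ?S \<le> t" using y by (simp add: simplex_pts_def)
    have "sum (h (y, d)) {1..n} = t + d"
      unfolding h_def prod.case sum_upd using le by simp
    moreover have "h (y, d) \<in> {1..n} \<rightarrow>\<^sub>E {0..<t + n * s}"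
    proof (rule PiE_I)
      fix k assume k: "k \<in> {1..n}"
      have "y k \<le> t" if "k \<noteq> i" using that k y by (simp add: simplex_pts_def PiE_iff)
      then show "h (y, d) k \<in> {0..<t + n * s}" using d by (auto simp: h_def)
    next
      fix k assume k: "k \<notin> {1..n}"
      then have "y k = undefined" using y by (auto simp: simplex_pts_def PiE_iff extensional_def)
      then show "h (y, d) k = undefined" using k i by (auto simp: h_def)
    qed
    ultimately show "h (y, d) \<in> slab_pts n s t"
      using d by (simp add: slab_pts_def)
  qed
  ultimately have "card (simplex_pts ?S t \<times> {..<n * s}) \<le> card (slab_pts n s t)"
    using finite_slab_pts by (metis card_inj_on_le)
  then show ?thesis by (simp add: card_cartesian_product mult.commute)
qed

section \<open>The potential and sparse lines\<close>

text \<open>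
  The term \<open>(s - 1) b\<close> makes the slope between consecutive blocks lie strictly between the slopes
  on them, so that leaving a block is always a strict increase.
\<close>

definition potential :: "nat \<Rightarrow> nat \<Rightarrow> nat \<Rightarrow> (nat \<Rightarrow> nat) \<Rightarrow> int" where
  "potential n s t x =
    (let u = sum x {1..n} - t; b = int (u div s)
     in 2 * b * int u - int s * b\<^sup>2 - (int s - 1) * b - 2 * (\<Sum>k\<in>{1..n}. (int k - 1) * int (x k)))"

text \<open>The line through \<open>u\<close> of slope \<open>2 * b u\<close> lies strictly below
  the function on all other blocks. With \<open>B = b v - b u\<close> and
  \<open>r = v mod s\<close>, the gap is \<open>B * (s * B + 2 * r - (s - 1))\<close>; since
  \<open>2 * r - (s - 1)\<close> has absolute value below \<open>s\<close>, the second factor has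
  the sign of \<open>B\<close>.\<close>

lemma block_function_supporting_line:
  fixes s u v :: nat
  assumes "s \<ge> 1" and ne: "u div s \<noteq> v div s"
  defines "b \<equiv> \<lambda>w. int (w div s)"
  shows "2 * b u * int u - int s * (b u)\<^sup>2 - (int s - 1) * b u + 2 * b u * (int v - int u)
       < 2 * b v * int v - int s * (b v)\<^sup>2 - (int s - 1) * b v"
proof -
  define r where "r = int (v mod s)"
  have v: "int v = int s * b v + r"
    unfolding b_def r_def by (metis mult_div_mod_eq of_nat_add of_nat_mult)
  have "v mod s < s" using assms(1) by simp
  then have r: "0 \<le> r" "r \<le> int s - 1" unfolding r_def by linarith+
  have diff: "2 * b v * int v - int s * (b v)\<^sup>2 - (int s - 1) * b v
      - (2 * b u * int u - int s * (b u)\<^sup>2 - (int s - 1) * b u + 2 * b u * (int v - int u))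
      = (b v - b u) * (int s * (b v - b u) + 2 * r - (int s - 1))"
    unfolding v by (simp add: algebra_simps power2_eq_square)
  have "b u \<noteq> b v" using ne by (simp add: b_def)
  then consider "b v - b u \<ge> 1" | "b v - b u \<le> -1" by linarith
  then have "(b v - b u) * (int s * (b v - b u) + 2 * r - (int s - 1)) > 0"
  proof cases
    case 1
    then have "int s * 1 \<le> int s * (b v - b u)" by (intro mult_left_mono) auto
    then show ?thesis using 1 r by (intro mult_pos_pos) linarith+
  next
    case 2
    then have "int s * (b v - b u) \<le> int s * (-1)" by (intro mult_left_mono) auto
    then show ?thesis using 2 r by (intro mult_neg_neg) linarith+
  qed
  then show ?thesis using diff by linarith
qed

text \<open>In direction \<open>i\<close> the linear functional has slope
  \<open>2 * (i - 1)\<close>, which \<open>dir\<close> makes equal to the slope of the supporting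
  line at \<open>x\<close>. The change of potential is thus the gap above that line.\<close>

lemma potential_increases:
  assumes s: "s \<ge> 1" and i: "i \<in> {1..n}"
    and x: "t \<le> sum x {1..n}" and x': "t \<le> sum (x(i := a)) {1..n}"
    and dir: "i = (sum x {1..n} - t) div s + 1"
    and ne: "(sum (x(i := a)) {1..n} - t) div s \<noteq> (sum x {1..n} - t) div s"
  shows "potential n s t x < potential n s t (x(i := a))"
proof -
  let ?S = "{1..n} - {i}"
  define u where "u = sum x {1..n} - t"
  define v where "v = sum (x(i := a)) {1..n} - t"
  define w where "w = (\<Sum>k\<in>?S. (int k - 1) * int (x k))"
  have sums: "sum x {1..n} = x i + sum x ?S" "sum (x(i := a)) {1..n} = a + sum x ?S"
    by (rule sum.remove[OF finite_atLeastAtMost i])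
      (rule sum_fun_upd_remove[OF finite_atLeastAtMost i])
  have uv: "int v - int u = int a - int (x i)"
    using x x' sums unfolding u_def v_def by simp
  have w1: "(\<Sum>k\<in>{1..n}. (int k - 1) * int (x k)) = (int i - 1) * int (x i) + w"
    using i unfolding w_def by (intro sum.remove) auto
  have w2: "(\<Sum>k\<in>{1..n}. (int k - 1) * int ((x(i := a)) k)) = (int i - 1) * int a + w"
  proof -
    have "(\<Sum>k\<in>{1..n}. (int k - 1) * int ((x(i := a)) k))
        = sum ((\<lambda>k. (int k - 1) * int (x k))(i := (int i - 1) * int a)) {1..n}"
      by (intro sum.cong) auto
    then show ?thesis
      unfolding w_def sum_fun_upd_remove[OF finite_atLeastAtMost i] .
  qed
  have iu: "int i - 1 = int (u div s)" using dir by (simp add: u_def)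
  have "2 * int (u div s) * int u - int s * (int (u div s))\<^sup>2 - (int s - 1) * int (u div s)
        + 2 * int (u div s) * (int a - int (x i))
       < 2 * int (v div s) * int v - int s * (int (v div s))\<^sup>2 - (int s - 1) * int (v div s)"
    using block_function_supporting_line[OF s, of u v] ne uv unfolding u_def v_def by metis
  then show ?thesis
    unfolding potential_def Let_def w1 w2 iu u_def[symmetric] v_def[symmetric]
    by (simp add: algebra_simps)
qed

lemma slab_pts_peelable:
  assumes s: "s \<ge> 1" and Y: "Y \<noteq> {}" "Y \<subseteq> slab_pts n s t"
  shows "\<exists>i\<in>{1..n}. MinDeg {0..<t + n * s} n i Y \<le> s"
proof -
  let ?\<phi> = "potential n s t"
  have fin: "finite Y" using Y finite_slab_pts finite_subset by blast
  then have "Max (?\<phi> ` Y) \<in> ?\<phi> ` Y" using Y by simp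
  then obtain x where x: "x \<in> Y" "?\<phi> x = Max (?\<phi> ` Y)" by auto
  have max: "?\<phi> y \<le> ?\<phi> x" if "y \<in> Y" for y
    using that fin x by simp
  define u where "u = sum x {1..n} - t"
  \<comment> \<open>Blocks are numbered from 0 and directions from 1; \<open>u < n * s\<close> gives
    \<open>i \<le> n\<close>.\<close>
  define i where "i = u div s + 1"
  have x_slab: "x \<in> {1..n} \<rightarrow>\<^sub>E {0..<t + n * s}" "t \<le> sum x {1..n}" "u < n * s"
    using x Y by (auto simp: slab_pts_def u_def)
  have i: "i \<in> {1..n}"
    using x_slab(3) s by (auto simp: i_def Suc_le_eq div_less_iff_less_mult)
  let ?S = "{1..n} - {i}"
  let ?G = "coord_graph {0..<t + n * s} n i Y"
  let ?y = "restrict x ?S"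
  have upd: "?y(i := a) = x(i := a)" for a
    using x_slab(1) by (auto simp: fun_eq_iff PiE_iff extensional_def)
  have y: "?y \<in> right_verts ?G"
    using x by (auto simp: coord_graph_def coord_proj_def)
  define L where "L = {a \<in> {0..<t + n * s}. (a, ?y) \<in> bi_edges ?G}"
  \<comment> \<open>Adding the sum of the fixed coordinates turns each value on the line into a
    coordinate sum, so \<open>L\<close> is translated into one block of \<open>s\<close> consecutive
    sums. Leaving the block would contradict the maximality of \<open>x\<close>.\<close>
  have "(+) (sum x ?S) ` L \<subseteq> {t + (i - 1) * s..<t + i * s}"
  proof clarify
    fix a assume "a \<in> L"
    then have "?y(i := a) \<in> Y" by (simp add: L_def coord_graph_def del: restrict_upd)
    then have a: "x(i := a) \<in> Y" by (simp only: upd)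
    then have ta: "t \<le> sum (x(i := a)) {1..n}" using Y by (auto simp: slab_pts_def)
    have blk: "(sum (x(i := a)) {1..n} - t) div s = u div s"
      using potential_increases[OF s i x_slab(2) ta] max[OF a]
      unfolding i_def u_def by fastforce
    have sm: "sum (x(i := a)) {1..n} = sum x ?S + a"
      using sum_fun_upd_remove[OF finite_atLeastAtMost i] by (simp only: add.commute)
    let ?v = "sum x ?S + a - t"
    have "?v div s = i - 1" using blk sm by (simp add: i_def)
    then have "(i - 1) * s \<le> ?v" "?v < i * s"
      using s i div_less_iff_less_mult[of s ?v i] div_times_less_eq_dividend[of ?v s] by auto
    then show "sum x ?S + a \<in> {t + (i - 1) * s..<t + i * s}"
      using ta sm by auto
  qed
  then have "card ((+) (sum x ?S) ` L) \<le> card {t + (i - 1) * s..<t + i * s}"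
    by (intro card_mono) auto
  also have "\<dots> = s" by (simp add: i_def)
  finally have "card L \<le> s" by (simp add: card_image)
  then have "right_degree ?G ?y \<le> s"
    by (simp add: right_degree_def L_def coord_graph_def)
  moreover have "finite (right_verts ?G)"
    using fin by (simp add: coord_graph_def coord_proj_def)
  then have "MinDeg {0..<t + n * s} n i Y \<le> right_degree ?G ?y"
    unfolding MinDeg_def using y by (intro Min_le) auto
  ultimately show ?thesis using i by (meson le_trans)
qed

section \<open>Average degrees and the choice of parameters\<close>

text \<open>The slab has at least \<open>n * s * ?p\<close> points, while its projection fits into
  the simplex of size \<open>t + n * s\<close>, which by \<open>slow\<close> has at most
  \<open>(1 + \<delta>) * ?p\<close> points.\<close>

lemma AvgDeg_slab_pts_ge:
  assumes i: "i \<in> {1..n}" and ns: "n * s \<ge> 1" and d: "\<delta> > 0"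
    and slow: "real (card (simplex_pts ({1..n} - {i}) (t + n * s)))
      \<le> (1 + \<delta>) * real (card (simplex_pts ({1..n} - {i}) t))"
  shows "AvgDeg n i (slab_pts n s t) \<ge> real (n * s) / (1 + \<delta>)"
proof -
  let ?S = "{1..n} - {i}"
  let ?p = "card (simplex_pts ?S t)" and ?q = "card (coord_proj ?S (slab_pts n s t))"
  have big: "n * s * ?p \<le> card (slab_pts n s t)" by (rule card_slab_pts_ge[OF i])
  have "1 \<le> ?p" by (rule card_simplex_pts_pos) simp
  then have "slab_pts n s t \<noteq> {}" using big ns by fastforce
  then have q0: "?q > 0"
    using finite_slab_pts by (simp add: coord_proj_def card_gt_0_iff)
  have "real ?q \<le> real (card (simplex_pts ?S (t + n * s)))"
    using card_mono[OF finite_simplex_pts coord_proj_slab_pts] by simp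
  also note slow
  finally have "real (n * s) * real ?q \<le> real (n * s) * ((1 + \<delta>) * real ?p)"
    by (intro mult_left_mono) auto
  also have "\<dots> = (1 + \<delta>) * real (n * s * ?p)" by simp
  also have "\<dots> \<le> (1 + \<delta>) * real (card (slab_pts n s t))"
    using big d by (intro mult_left_mono) (auto simp only: of_nat_le_iff)
  finally show ?thesis
    unfolding AvgDeg_def using q0 d by (simp add: field_simps)
qed

theorem theorem3:
  fixes \<epsilon> :: real and n s :: nat
  assumes "\<epsilon> > 0" and "n \<ge> 2" and "s \<ge> 1"
  shows "\<exists>(m::nat) (X :: (nat \<Rightarrow> nat) set).
           m > 0 \<and> X \<noteq> {} \<and> X \<subseteq> ({1..n} \<rightarrow>\<^sub>E {0..<m}) \<and>
           (\<forall>i\<in>{1..n}. AvgDeg n i X \<ge> real s * (real n - \<epsilon>)) \<and>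
           \<not> (\<exists>Y. Y \<noteq> {} \<and> Y \<subseteq> X \<and> (\<forall>i\<in>{1..n}. MinDeg {0..<m} n i Y \<ge> s + 1))"
proof -
  \<comment> \<open>Chosen so that the linear terms cancel: \<open>(n - \<epsilon>) * (1 +
    \<epsilon> / n) = n - \<epsilon> * \<delta>\<close>, which is at most \<open>n\<close>.\<close>
  define \<delta> where "\<delta> = \<epsilon> / real n"
  have d: "\<delta> > 0" using assms by (simp add: \<delta>_def)
  have ns: "n * s \<ge> 1" using assms by simp
  define P where "P = (\<lambda>i T. real (card (simplex_pts ({1..n} - {i}) T)))"
  have "\<exists>t. \<forall>i\<in>{1..n}. P i (t + n * s) \<le> (1 + \<delta>) * P i t"
  \<comment> \<open>The exponent \<open>n - 1\<close> is the number of coordinates left after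
    deleting \<open>i\<close>.\<close>
  proof (rule poly_bounded_family_slow_step[where d = "n - 1"])
    fix i assume i: "i \<in> {1..n}"
    show "mono (P i)"
      unfolding P_def by (auto intro!: monoI card_mono finite_simplex_pts simplex_pts_mono)
    show "1 \<le> P i T" for T
      using card_simplex_pts_pos[of "{1..n} - {i}" T] by (simp add: P_def)
    show "P i T \<le> (real T + 1) ^ (n - 1)" for T
    proof -
      have "card (simplex_pts ({1..n} - {i}) T) \<le> (T + 1) ^ (n - 1)"
        using card_simplex_pts_le[of "{1..n} - {i}" T] i by simp
      then have "P i T \<le> real ((T + 1) ^ (n - 1))" unfolding P_def of_nat_le_iff .
      then show ?thesis by (simp add: add.commute)
    qed
  qed (use d in auto)
  then obtain t where t: "\<And>i. i \<in> {1..n} \<Longrightarrow> P i (t + n * s) \<le> (1 + \<delta>) * P i t"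
    by blast
  have avg: "AvgDeg n i (slab_pts n s t) \<ge> real s * (real n - \<epsilon>)" if i: "i \<in> {1..n}" for i
  proof -
    have "(real n - \<epsilon>) * (1 + \<delta>) = real n - \<epsilon> * \<delta>"
      using assms by (simp add: \<delta>_def field_simps)
    also have "\<dots> \<le> real n" using assms d by simp
    finally have "real n - \<epsilon> \<le> real n / (1 + \<delta>)" using d by (simp add: field_simps)
    then have "real s * (real n - \<epsilon>) \<le> real s * (real n / (1 + \<delta>))"
      by (intro mult_left_mono) auto
    also have "\<dots> = real (n * s) / (1 + \<delta>)" by simp
    also have "\<dots> \<le> AvgDeg n i (slab_pts n s t)"
      using AvgDeg_slab_pts_ge[OF i ns d] t[OF i] by (simp add: P_def)
    finally show ?thesis .
  qed
  have "n * s * card (simplex_pts ({1..n} - {1}) t) \<le> card (slab_pts n s t)"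
    using assms by (intro card_slab_pts_ge) auto
  moreover have "1 \<le> card (simplex_pts ({1..n} - {1}) t)"
    by (rule card_simplex_pts_pos) simp
  ultimately have "slab_pts n s t \<noteq> {}" using ns by fastforce
  moreover have "slab_pts n s t \<subseteq> {1..n} \<rightarrow>\<^sub>E {0..<t + n * s}"
    by (auto simp: slab_pts_def)
  moreover have "t + n * s > 0" using ns by simp
  moreover have "\<not> (\<exists>Y. Y \<noteq> {} \<and> Y \<subseteq> slab_pts n s t \<and>
      (\<forall>i\<in>{1..n}. MinDeg {0..<t + n * s} n i Y \<ge> s + 1))"
    using slab_pts_peelable[OF assms(3)] by (metis Suc_eq_plus1 not_less_eq_eq)
  ultimately show ?thesis
    using avg by (intro exI[of _ "t + n * s"] exI[of _ "slab_pts n s t"] conjI ballI)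
qed

end
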